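(* Assume that $\mathbb{S}(I)$ contains the identity map $\mathrm{id}_I$, and let $f,g\in T_{\mathbb{S}(I)}(X,\mathcal{P})$. Then $(f,g)\in \mathcal{D}$ in $T_{\mathbb{S}(I)}(X,\mathcal{P})$ if and only if there exist $\alpha,\beta,\gamma\in \mathbb{S}(I)$ and a bijection $\varphi\colon \pi(f)\to \pi(g)$ such that: (i) $\chi^{(f)}=\alpha\gamma$, $\gamma=\beta\chi^{(f)}$, and $\left(\gamma,\chi^{(g)}\right)\in \mathcal{R}$ in $\mathbb{S}(I)$; (ii) $\pi_{X_i}(f)\varphi\subseteq \pi_{X_{i\alpha}}(g)$ for all $i\in I$; and (iii) $\pi_{X_i}(g)\varphi^{-1}\subseteq \pi_{X_{i\beta}}(f)$ for all $i\in I$.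
   Context: $X$ is a nonempty set (possibly infinite) and $\mathcal{P}=\{X_i : i\in I\}$ is a partition of $X$ into nonempty blocks, with $X_i\cap X_j=\varnothing$ for $i\neq j$. $T(Z)$ denotes the semigroup of all maps $Z\to Z$ under composition. Maps are written on the right and composed from left to right: $x(fg)=(xf)g$; $Af=\{af: a\in A\}$. $T(X,\mathcal{P})$ is the subsemigroup of all $f\in T(X)$ such that for every $i\in I$ there is $j\in I$ with $X_if\subseteq X_j$. For $f\in T(X,\mathcal{P})$ the character $\chi^{(f)}\in T(I)$ is defined by $i\chi^{(f)}=j$ whenever $X_if\subseteq X_j$. For a subsemigroup $\mathbb{S}(I)$ of $T(I)$, $T_{\mathbb{S}(I)}(X,\mathcal{P})=\{f\in T(X,\mathcal{P}): \chi^{(f)}\in \mathbb{S}(I)\}$, a subsemigroup of $T(X,\mathcal{P})$; it contains $\mathrm{id}_X$ iff $\mathrm{id}_I\in\mathbb{S}(I)$. In a semigroup $S$ with identity, Green's relations are: $(a,b)\in\mathcal{L}$ iff $Sa=Sb$; $(a,b)\in\mathcal{R}$ iff $aS=bS$; and $\mathcal{D}=\mathcal{L}\circ\mathcal{R}=\mathcal{R}\circ\mathcal{L}$. For $f\in T(X)$, $\pi(f)$ is the partition of $X$ into the classes of $\ker(f)=\{(a,b)\in X\times X: af=bf\}$, and for $A\subseteq X$, $\pi_A(f)=\{M\in\pi(f): M\cap A\neq\varnothing\}$. *)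

theory Defs
  imports "HOL-Algebra.Coset" "HOL-Library.Disjoint_Sets" "HOL-Library.FuncSet"
begin

text \<open>Transformations of a set \<open>Z\<close> are extensional functions \<open>Z \<rightarrow>\<^sub>E Z\<close>.  Maps act on the right:
  the product of \<open>f\<close> and \<open>g\<close> is ``first \<open>f\<close>, then \<open>g\<close>''.\<close>

definition transf_monoid :: "'a set \<Rightarrow> ('a \<Rightarrow> 'a) monoid" where
  "transf_monoid Z = \<lparr>carrier = Z \<rightarrow>\<^sub>E Z, mult = (\<lambda>f g. compose Z g f), one = (\<lambda>x\<in>Z. x)\<rparr>"

definition indexed_partition :: "'a set \<Rightarrow> 'i set \<Rightarrow> ('i \<Rightarrow> 'a set) \<Rightarrow> bool" where
  "indexed_partition X I B \<longleftrightarrow> partition_on X (B ` I) \<and> disjoint_family_on B I"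

definition partition_preserving :: "'a set \<Rightarrow> 'i set \<Rightarrow> ('i \<Rightarrow> 'a set) \<Rightarrow> ('a \<Rightarrow> 'a) set" where
  "partition_preserving X I B =
     {f \<in> carrier (transf_monoid X). \<forall>i\<in>I. \<exists>j\<in>I. f ` B i \<subseteq> B j}"

definition character :: "'i set \<Rightarrow> ('i \<Rightarrow> 'a set) \<Rightarrow> ('a \<Rightarrow> 'a) \<Rightarrow> ('i \<Rightarrow> 'i)" where
  "character I B f = (\<lambda>i\<in>I. THE j. j \<in> I \<and> f ` B i \<subseteq> B j)"

definition char_monoid ::
  "'a set \<Rightarrow> 'i set \<Rightarrow> ('i \<Rightarrow> 'a set) \<Rightarrow> ('i \<Rightarrow> 'i) set \<Rightarrow> ('a \<Rightarrow> 'a) monoid" where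
  "char_monoid X I B S =
     (transf_monoid X)\<lparr>carrier := {f \<in> partition_preserving X I B. character I B f \<in> S}\<rparr>"

text \<open>Green's relations of a semigroup \<open>M\<close> with identity.  The coset notation
  \<open>carrier M #>\<^bsub>M\<^esub> a\<close> denotes the principal left ideal \<open>M a\<close>, and \<open>a <#\<^bsub>M\<^esub> carrier M\<close>
  the principal right ideal \<open>a M\<close>.\<close>

definition green_L :: "('a, 'b) monoid_scheme \<Rightarrow> 'a rel" where
  "green_L M = {(a, b) \<in> carrier M \<times> carrier M. carrier M #>\<^bsub>M\<^esub> a = carrier M #>\<^bsub>M\<^esub> b}"

definition green_R :: "('a, 'b) monoid_scheme \<Rightarrow> 'a rel" where
  "green_R M = {(a, b) \<in> carrier M \<times> carrier M. a <#\<^bsub>M\<^esub> carrier M = b <#\<^bsub>M\<^esub> carrier M}"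

definition green_D :: "('a, 'b) monoid_scheme \<Rightarrow> 'a rel" where
  "green_D M = green_L M O green_R M"

definition ker_rel :: "'a set \<Rightarrow> ('a \<Rightarrow> 'a) \<Rightarrow> 'a rel" where
  "ker_rel X f = {(a, b) \<in> X \<times> X. f a = f b}"

definition ker_classes :: "'a set \<Rightarrow> ('a \<Rightarrow> 'a) \<Rightarrow> 'a set set" where
  "ker_classes X f = X // ker_rel X f"

definition ker_classes_meeting :: "'a set \<Rightarrow> ('a \<Rightarrow> 'a) \<Rightarrow> 'a set \<Rightarrow> 'a set set" where
  "ker_classes_meeting X f A = {M \<in> ker_classes X f. M \<inter> A \<noteq> {}}"

end

theory Submission
  imports Defs
begin

text \<open>
  A multiplier \<open>p\<close> with \<open>f = p h\<close> has to send each \<open>x\<close> to a point where \<open>h\<close> takes the value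
  \<open>f x\<close>, and a multiplier \<open>u\<close> with \<open>h = g u\<close> is forced on the image of \<open>g\<close> and free elsewhere.
  Hence left multiples are a question about images, right multiples a question about kernels, and in
  both cases the multiplier can be built point by point inside the block that a prescribed character
  dictates; this is the content of \<open>left_factorization\<close> and \<open>right_factorization\<close>.

  Suppose \<open>f \<L> h \<R> g\<close>. Then \<open>h\<close> has the image of \<open>f\<close> and the kernel of \<open>g\<close>, so matching the
  kernel classes of \<open>f\<close> and \<open>h\<close> that have the same value is a bijection \<open>\<phi>\<close> from the kernel classes
  of \<open>f\<close> to those of \<open>g\<close>. If \<open>f = p h\<close> and \<open>h = q f\<close>, then \<open>p\<close> moves a point of a class \<open>M\<close> into the
  class \<open>\<phi> M\<close>, and \<open>q\<close> does the same for the inverse of \<open>\<phi>\<close>; the characters of \<open>p\<close>, \<open>q\<close>, \<open>h\<close> are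
  \<open>\<alpha>\<close>, \<open>\<beta>\<close>, \<open>\<gamma>\<close>.

  Conversely, given \<open>\<phi>\<close>, let \<open>h\<close> take on the class \<open>\<phi> M\<close> of \<open>g\<close> the value that \<open>f\<close> takes on \<open>M\<close>
  (\<open>transport_along_class_bijection\<close>). The two conditions on blocks say exactly that the points
  needed for \<open>p\<close> and \<open>q\<close> can be found in the blocks prescribed by \<open>\<alpha>\<close> and \<open>\<beta>\<close>, and
  \<open>\<gamma> = \<beta> \<chi>\<^sup>f\<close> forces the character of \<open>h\<close> to be \<open>\<gamma>\<close>. Since \<open>h\<close> and \<open>g\<close> have equal kernels, the
  relation \<open>\<R>\<close> between \<open>\<gamma>\<close> and the character of \<open>g\<close> lifts to \<open>h \<R> g\<close>.
\<close>

section \<open>Green's relations as mutual divisibility\<close>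

text \<open>The identity puts each element into its own principal ideal, so that equality of principal
  ideals amounts to each of the two elements being a multiple of the other.\<close>

lemma (in monoid) green_L_iff:
  "(a, b) \<in> green_L G \<longleftrightarrow> a \<in> carrier G \<and> b \<in> carrier G \<and>
     (\<exists>p\<in>carrier G. a = p \<otimes> b) \<and> (\<exists>q\<in>carrier G. b = q \<otimes> a)"
proof -
  have sub: "carrier G #> x \<subseteq> carrier G #> y"
    if "y \<in> carrier G" "p \<in> carrier G" "x = p \<otimes> y" for x y p
    using that by (auto simp: r_coset_def m_assoc[symmetric])
  have mem: "x \<in> carrier G #> x" if "x \<in> carrier G" for x
    using that unfolding r_coset_def by (auto intro!: bexI[of _ \<one>])
  show ?thesis
  proof
    assume "(a, b) \<in> green_L G"
    then have ab: "a \<in> carrier G" "b \<in> carrier G" "carrier G #> a = carrier G #> b"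
      by (auto simp: green_L_def)
    then have "a \<in> carrier G #> b" "b \<in> carrier G #> a"
      using mem by auto
    then show "a \<in> carrier G \<and> b \<in> carrier G \<and>
        (\<exists>p\<in>carrier G. a = p \<otimes> b) \<and> (\<exists>q\<in>carrier G. b = q \<otimes> a)"
      using ab by (auto simp: r_coset_def)
  next
    assume "a \<in> carrier G \<and> b \<in> carrier G \<and>
        (\<exists>p\<in>carrier G. a = p \<otimes> b) \<and> (\<exists>q\<in>carrier G. b = q \<otimes> a)"
    then obtain p q where "a \<in> carrier G" "b \<in> carrier G"
      and "p \<in> carrier G" "a = p \<otimes> b" "q \<in> carrier G" "b = q \<otimes> a"
      by blast
    note ab = this
    have "carrier G #> a = carrier G #> b"
      using sub[OF ab(2,3,4)] sub[OF ab(1,5,6)] by (rule subset_antisym)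
    then show "(a, b) \<in> green_L G"
      using ab(1,2) by (simp add: green_L_def)
  qed
qed

lemma (in monoid) green_R_iff:
  "(a, b) \<in> green_R G \<longleftrightarrow> a \<in> carrier G \<and> b \<in> carrier G \<and>
     (\<exists>u\<in>carrier G. a = b \<otimes> u) \<and> (\<exists>v\<in>carrier G. b = a \<otimes> v)"
proof -
  have sub: "x <# carrier G \<subseteq> y <# carrier G"
    if "y \<in> carrier G" "p \<in> carrier G" "x = y \<otimes> p" for x y p
    using that by (auto simp: l_coset_def m_assoc)
  have mem: "x \<in> x <# carrier G" if "x \<in> carrier G" for x
    using that unfolding l_coset_def by (auto intro!: bexI[of _ \<one>])
  show ?thesis
  proof
    assume "(a, b) \<in> green_R G"
    then have ab: "a \<in> carrier G" "b \<in> carrier G" "a <# carrier G = b <# carrier G"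
      by (auto simp: green_R_def)
    then have "a \<in> b <# carrier G" "b \<in> a <# carrier G"
      using mem by auto
    then show "a \<in> carrier G \<and> b \<in> carrier G \<and>
        (\<exists>u\<in>carrier G. a = b \<otimes> u) \<and> (\<exists>v\<in>carrier G. b = a \<otimes> v)"
      using ab by (auto simp: l_coset_def)
  next
    assume "a \<in> carrier G \<and> b \<in> carrier G \<and>
        (\<exists>u\<in>carrier G. a = b \<otimes> u) \<and> (\<exists>v\<in>carrier G. b = a \<otimes> v)"
    then obtain p q where "a \<in> carrier G" "b \<in> carrier G"
      and "p \<in> carrier G" "a = b \<otimes> p" "q \<in> carrier G" "b = a \<otimes> q"
      by blast
    note ab = this
    have "a <# carrier G = b <# carrier G"
      using sub[OF ab(2,3,4)] sub[OF ab(1,5,6)] by (rule subset_antisym)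
    then show "(a, b) \<in> green_R G"
      using ab(1,2) by (simp add: green_R_def)
  qed
qed

section \<open>Kernel classes\<close>

lemma ker_classes_eq_image: "ker_classes X f = (\<lambda>x. {y \<in> X. f y = f x}) ` X"
proof -
  have "ker_rel X f `` {x} = {y \<in> X. f y = f x}" if "x \<in> X" for x
    using that by (auto simp: ker_rel_def)
  then show ?thesis
    by (auto simp: ker_classes_def quotient_def)
qed

lemma ker_classes_cong:
  assumes "\<And>x y. x \<in> X \<Longrightarrow> y \<in> X \<Longrightarrow> g x = g y \<longleftrightarrow> h x = h y"
  shows "ker_classes X g = ker_classes X h"
  unfolding ker_classes_eq_image using assms by (auto intro!: image_cong)

lemma ker_class_memD:
  assumes "M \<in> ker_classes X f" "y \<in> M"
  shows "y \<in> X" "M = {x \<in> X. f x = f y}"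
  using assms by (auto simp: ker_classes_eq_image)

lemma ker_class_of_meeting:
  assumes "x \<in> A" "x \<in> X"
  shows "{y \<in> X. f y = f x} \<in> ker_classes_meeting X f A"
  using assms by (auto simp: ker_classes_meeting_def ker_classes_eq_image)

text \<open>Kernel classes correspond to values, so maps with the same image have their kernel classes
  matched by comparing values.\<close>

lemma bij_betw_ker_classes_of_equal_image:
  fixes f h :: "'a \<Rightarrow> 'a"
  assumes "f ` X = h ` X"
  shows "bij_betw (\<lambda>M. {x \<in> X. h x \<in> f ` M}) (ker_classes X f) (ker_classes X h)"
proof -
  have matched: "{x \<in> X. k' x \<in> k ` M} \<in> ker_classes X k' \<and>
      {y \<in> X. k y \<in> k' ` {x \<in> X. k' x \<in> k ` M}} = M"
    if "M \<in> ker_classes X k" "k ` X = k' ` X" for k k' :: "'a \<Rightarrow> 'a" and M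
  proof -
    obtain y where y: "y \<in> X" "M = {x \<in> X. k x = k y}"
      using \<open>M \<in> ker_classes X k\<close> by (auto simp: ker_classes_eq_image)
    obtain z where z: "z \<in> X" "k y = k' z"
      using y(1) \<open>k ` X = k' ` X\<close> by (metis imageE imageI)
    have "k ` M = {k y}"
      using y by auto
    then have eq: "{x \<in> X. k' x \<in> k ` M} = {x \<in> X. k' x = k' z}"
      using z by auto
    have "k' ` {x \<in> X. k' x = k' z} = {k y}"
      using z by auto
    then show ?thesis
      unfolding eq using y z by (auto simp: ker_classes_eq_image)
  qed
  show ?thesis
    by (rule bij_betw_byWitness[where f' = "\<lambda>N. {y \<in> X. f y \<in> h ` N}"])
      (use matched assms in \<open>auto\<close>)
qed

text \<open>The map that takes on each class \<open>\<phi> M\<close> of \<open>g\<close> the constant value of \<open>f\<close> on \<open>M\<close> is well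
  defined because the classes of \<open>g\<close> partition \<open>X\<close>. It separates the classes of \<open>g\<close> because \<open>f\<close>
  separates its own, so it inherits the kernel of \<open>g\<close>.\<close>

lemma transport_along_class_bijection:
  assumes f: "f \<in> X \<rightarrow>\<^sub>E X"
    and bij: "bij_betw \<phi> (ker_classes X f) (ker_classes X g)"
  obtains h where "h \<in> X \<rightarrow>\<^sub>E X"
    and "\<And>M x y. M \<in> ker_classes X f \<Longrightarrow> y \<in> M \<Longrightarrow> x \<in> \<phi> M \<Longrightarrow> h x = f y"
    and "\<And>x y. x \<in> X \<Longrightarrow> y \<in> X \<Longrightarrow> h x = h y \<longleftrightarrow> g x = g y"
proof -
  \<comment> \<open>\<open>pre x\<close> is the class of \<open>f\<close> whose image under \<open>\<phi>\<close> contains \<open>x\<close>; any representative of it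
    gives the same value of \<open>f\<close>.\<close>
  define pre where "pre x = inv_into (ker_classes X f) \<phi> {y \<in> X. g y = g x}" for x
  define h where "h = (\<lambda>x\<in>X. f (SOME y. y \<in> pre x))"
  have pre: "pre x \<in> ker_classes X f" "\<phi> (pre x) = {y \<in> X. g y = g x}" if "x \<in> X" for x
  proof -
    have "{y \<in> X. g y = g x} \<in> ker_classes X g"
      using that by (auto simp: ker_classes_eq_image)
    then show "pre x \<in> ker_classes X f" "\<phi> (pre x) = {y \<in> X. g y = g x}"
      unfolding pre_def using bij
      by (auto simp: bij_betw_def inv_into_into f_inv_into_f)
  qed
  have some: "(SOME y. y \<in> pre x) \<in> pre x" if "x \<in> X" for x
    using pre(1)[OF that] unfolding some_in_eq by (auto simp: ker_classes_eq_image)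
  have h_pre: "h x = f y" if "x \<in> X" "y \<in> pre x" for x y
    using ker_class_memD(2)[OF pre(1)[OF that(1)] that(2)] some[OF that(1)] that(1)
    by (auto simp: h_def)
  have val: "h x = f y" if "M \<in> ker_classes X f" "y \<in> M" "x \<in> \<phi> M" for M x y
  proof -
    have N: "\<phi> M \<in> ker_classes X g"
      using that(1) bij by (auto simp: bij_betw_def)
    note x = ker_class_memD[OF N that(3)]
    have "M = pre x"
      using pre[OF x(1)] x(2) that(1) bij by (auto simp: bij_betw_def inj_on_def)
    then show ?thesis
      using h_pre x(1) that(2) by auto
  qed
  show ?thesis
  proof (rule that)
    show "h \<in> X \<rightarrow>\<^sub>E X"
      using f some ker_class_memD(1)[OF pre(1) some] unfolding h_def by auto
    show "h x = f y" if "M \<in> ker_classes X f" "y \<in> M" "x \<in> \<phi> M" for M x y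
      using that by (rule val)
    show "h x = h y \<longleftrightarrow> g x = g y" if xy: "x \<in> X" "y \<in> X" for x y
    proof
      assume "g x = g y"
      then have "pre x = pre y"
        by (simp add: pre_def)
      then show "h x = h y"
        using xy by (simp add: h_def)
    next
      assume "h x = h y"
      then have "f (SOME z. z \<in> pre x) = f (SOME z. z \<in> pre y)"
        using xy by (simp add: h_def)
      then have "pre x = pre y"
        using ker_class_memD(2)[OF pre(1) some, OF xy(1) xy(1)]
          ker_class_memD(2)[OF pre(1) some, OF xy(2) xy(2)] by presburger
      then have "{z \<in> X. g z = g x} = {z \<in> X. g z = g y}"
        using pre(2)[OF xy(1)] pre(2)[OF xy(2)] by metis
      then show "g x = g y"
        using xy by blast
    qed
  qed
qed

section \<open>Maps that preserve a partition\<close>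

lemma monoid_transf_monoid: "monoid (transf_monoid Z)"
proof (rule monoidI)
  show "x \<otimes>\<^bsub>transf_monoid Z\<^esub> y \<otimes>\<^bsub>transf_monoid Z\<^esub> z =
      x \<otimes>\<^bsub>transf_monoid Z\<^esub> (y \<otimes>\<^bsub>transf_monoid Z\<^esub> z)"
    if "x \<in> carrier (transf_monoid Z)" for x y z
    using that compose_assoc[of x Z Z z y]
    by (auto simp: transf_monoid_def)
qed (auto simp: transf_monoid_def Id_compose compose_Id PiE_def compose_def extensional_def fun_eq_iff)

locale block_monoid =
  fixes X :: "'a set" and I :: "'i set" and B :: "'i \<Rightarrow> 'a set" and S :: "('i \<Rightarrow> 'i) set"
  assumes part: "indexed_partition X I B"
    and sub: "submonoid S (transf_monoid I)"
begin

lemma S_maps: "\<sigma> \<in> S \<Longrightarrow> \<sigma> \<in> I \<rightarrow>\<^sub>E I"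
  using submonoid.subset[OF sub] by (auto simp: transf_monoid_def)

lemma in_block: "x \<in> X \<Longrightarrow> \<exists>i\<in>I. x \<in> B i"
  using part by (auto simp: indexed_partition_def partition_on_def)

lemma block_subset: "i \<in> I \<Longrightarrow> x \<in> B i \<Longrightarrow> x \<in> X"
  using part by (auto simp: indexed_partition_def partition_on_def)

lemma block_nonempty: "i \<in> I \<Longrightarrow> \<exists>x. x \<in> B i"
  using part by (auto simp: indexed_partition_def partition_on_def)

lemma block_unique: "i \<in> I \<Longrightarrow> j \<in> I \<Longrightarrow> x \<in> B i \<Longrightarrow> x \<in> B j \<Longrightarrow> i = j"
  using part by (auto simp: indexed_partition_def disjoint_family_on_def)

text \<open>Blocks are nonempty and disjoint, so a map can only have one character; exhibiting a
  candidate suffices to identify it.\<close>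

lemma character_eqI:
  assumes "\<sigma> \<in> I \<rightarrow>\<^sub>E I" "\<And>i x. i \<in> I \<Longrightarrow> x \<in> B i \<Longrightarrow> f x \<in> B (\<sigma> i)"
  shows "character I B f = \<sigma>"
proof (rule extensionalityI[of _ I])
  fix i assume i: "i \<in> I"
  have "(THE j. j \<in> I \<and> f ` B i \<subseteq> B j) = \<sigma> i"
  proof (rule the_equality)
    show "\<sigma> i \<in> I \<and> f ` B i \<subseteq> B (\<sigma> i)"
      using assms i by auto
    fix j assume j: "j \<in> I \<and> f ` B i \<subseteq> B j"
    obtain x where "x \<in> B i"
      using block_nonempty[OF i] by blast
    then show "j = \<sigma> i"
      using j i assms(2)[OF i] PiE_mem[OF assms(1) i] block_unique[of j "\<sigma> i" "f x"] by blast
  qed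
  then show "character I B f i = \<sigma> i"
    using i by (simp add: character_def)
qed (use assms(1) in \<open>auto simp: character_def PiE_iff\<close>)

lemma character_maps:
  assumes "f \<in> carrier (char_monoid X I B S)" "i \<in> I" "x \<in> B i"
  shows "f x \<in> B (character I B f i)"
proof -
  obtain j where "j \<in> I" "f ` B i \<subseteq> B j"
    using assms by (auto simp: char_monoid_def partition_preserving_def)
  moreover have "j' = j" if "j' \<in> I \<and> f ` B i \<subseteq> B j'" for j'
    using that calculation assms(3) block_unique[of j' j "f x"] by blast
  ultimately have "(THE j. j \<in> I \<and> f ` B i \<subseteq> B j) = j"
    by (intro the_equality) blast+
  then show ?thesis
    using \<open>f ` B i \<subseteq> B j\<close> assms by (auto simp: character_def)
qed

lemma carrierD:
  assumes "f \<in> carrier (char_monoid X I B S)"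
  shows "f \<in> X \<rightarrow>\<^sub>E X" "character I B f \<in> S"
  using assms by (auto simp: char_monoid_def partition_preserving_def transf_monoid_def)

lemma carrierI:
  assumes "f \<in> extensional X" "\<sigma> \<in> S" "\<And>i x. i \<in> I \<Longrightarrow> x \<in> B i \<Longrightarrow> f x \<in> B (\<sigma> i)"
  shows "f \<in> carrier (char_monoid X I B S)" "character I B f = \<sigma>"
proof -
  have \<sigma>: "\<sigma> \<in> I \<rightarrow>\<^sub>E I"
    using assms(2) by (rule S_maps)
  show chi: "character I B f = \<sigma>"
    using \<sigma> assms(3) by (rule character_eqI)
  have "f x \<in> X" if "x \<in> X" for x
    using in_block[OF that] assms(3) \<sigma> block_subset by (metis PiE_mem)
  then have "f \<in> X \<rightarrow>\<^sub>E X"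
    using assms(1) by (auto simp: PiE_iff)
  moreover have "\<forall>i\<in>I. \<exists>j\<in>I. f ` B i \<subseteq> B j"
    using assms(3) \<sigma> by (metis PiE_mem image_subsetI)
  ultimately show "f \<in> carrier (char_monoid X I B S)"
    using chi assms(2)
    by (auto simp: char_monoid_def partition_preserving_def transf_monoid_def)
qed

lemma mult_char_monoid: "f \<otimes>\<^bsub>char_monoid X I B S\<^esub> g = compose X g f"
  by (simp add: char_monoid_def transf_monoid_def)

lemma mult_S_closed: "\<sigma> \<in> S \<Longrightarrow> \<tau> \<in> S \<Longrightarrow> compose I \<tau> \<sigma> \<in> S"
  using submonoid.m_closed[OF sub, of \<sigma> \<tau>] by (simp add: transf_monoid_def)

lemma
  assumes "f \<in> carrier (char_monoid X I B S)" "g \<in> carrier (char_monoid X I B S)"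
  shows mult_carrier: "compose X g f \<in> carrier (char_monoid X I B S)"
    and character_mult:
      "character I B (compose X g f) = compose I (character I B g) (character I B f)"
proof -
  have maps: "compose X g f x \<in> B (compose I (character I B g) (character I B f) i)"
    if "i \<in> I" "x \<in> B i" for i x
    using character_maps[OF assms(2) _ character_maps[OF assms(1) that]]
      PiE_mem[OF S_maps[OF carrierD(2)[OF assms(1)]] that(1)] block_subset[OF that] that(1)
    by (simp add: compose_eq)
  note char = carrierI[OF compose_extensional
      mult_S_closed[OF carrierD(2)[OF assms(1)] carrierD(2)[OF assms(2)]] maps]
  show "compose X g f \<in> carrier (char_monoid X I B S)"
    by (rule char(1))
  show "character I B (compose X g f) = compose I (character I B g) (character I B f)"
    by (rule char(2))
qed

lemma monoid_S: "monoid ((transf_monoid I)\<lparr>carrier := S\<rparr>)"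
  using submonoid.submonoid_is_monoid[OF sub monoid_transf_monoid] .

lemma green_R_S_iff:
  "(\<sigma>, \<tau>) \<in> green_R ((transf_monoid I)\<lparr>carrier := S\<rparr>) \<longleftrightarrow> \<sigma> \<in> S \<and> \<tau> \<in> S \<and>
     (\<exists>\<delta>\<in>S. \<sigma> = compose I \<delta> \<tau>) \<and> (\<exists>\<epsilon>\<in>S. \<tau> = compose I \<epsilon> \<sigma>)"
  unfolding monoid.green_R_iff[OF monoid_S] by (simp add: transf_monoid_def)

lemma monoid_char_monoid: "monoid (char_monoid X I B S)"
proof -
  have "submonoid (carrier (char_monoid X I B S)) (transf_monoid X)"
  proof (unfold_locales)
    show "carrier (char_monoid X I B S) \<subseteq> carrier (transf_monoid X)"
      using carrierD(1) by (auto simp: transf_monoid_def)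
    show "\<one>\<^bsub>transf_monoid X\<^esub> \<in> carrier (char_monoid X I B S)"
      using carrierI(1)[of "\<lambda>x\<in>X. x" "\<lambda>i\<in>I. i"] submonoid.one_closed[OF sub] block_subset
      by (auto simp: transf_monoid_def)
    show "f \<otimes>\<^bsub>transf_monoid X\<^esub> g \<in> carrier (char_monoid X I B S)"
      if "f \<in> carrier (char_monoid X I B S)" "g \<in> carrier (char_monoid X I B S)" for f g
      using mult_carrier[OF that] by (simp add: transf_monoid_def)
  qed
  then have "monoid ((transf_monoid X)\<lparr>carrier := carrier (char_monoid X I B S)\<rparr>)"
    using submonoid.submonoid_is_monoid[OF _ monoid_transf_monoid] by blast
  then show ?thesis
    by (simp add: char_monoid_def)
qed

lemma green_L_char_monoid_divisibility:
  "(f, h) \<in> green_L (char_monoid X I B S) \<longleftrightarrow>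
     f \<in> carrier (char_monoid X I B S) \<and> h \<in> carrier (char_monoid X I B S) \<and>
     (\<exists>p\<in>carrier (char_monoid X I B S). f = compose X h p) \<and>
     (\<exists>q\<in>carrier (char_monoid X I B S). h = compose X f q)"
  unfolding monoid.green_L_iff[OF monoid_char_monoid] mult_char_monoid by (rule refl)

lemma green_R_char_monoid_divisibility:
  "(h, g) \<in> green_R (char_monoid X I B S) \<longleftrightarrow>
     h \<in> carrier (char_monoid X I B S) \<and> g \<in> carrier (char_monoid X I B S) \<and>
     (\<exists>u\<in>carrier (char_monoid X I B S). h = compose X u g) \<and>
     (\<exists>v\<in>carrier (char_monoid X I B S). g = compose X v h)"
  unfolding monoid.green_R_iff[OF monoid_char_monoid] mult_char_monoid by (rule refl)

section \<open>Multipliers with a prescribed character\<close>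

text \<open>Composing with \<open>h\<close> on the right leaves one requirement on \<open>p x\<close>, namely \<open>h (p x) = f x\<close>. It
  concerns each point separately, and so does membership of \<open>p x\<close> in a prescribed block; the values
  can therefore be chosen independently of each other.\<close>

lemma left_factorization:
  assumes "f \<in> X \<rightarrow>\<^sub>E X" "\<alpha> \<in> S"
    and "\<And>i x. i \<in> I \<Longrightarrow> x \<in> B i \<Longrightarrow> \<exists>y\<in>B (\<alpha> i). h y = f x"
  shows "\<exists>p\<in>carrier (char_monoid X I B S). f = compose X h p"
proof -
  have "\<exists>y. \<forall>i\<in>I. x \<in> B i \<longrightarrow> y \<in> B (\<alpha> i) \<and> h y = f x" if x: "x \<in> X" for x
  proof -
    obtain i where i: "i \<in> I" "x \<in> B i"
      using in_block[OF x] by blast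
    then obtain y where "y \<in> B (\<alpha> i)" "h y = f x"
      using assms(3) by blast
    then show ?thesis
      using block_unique[OF i(1) _ i(2)] by blast
  qed
  then obtain p where p: "\<And>x i. x \<in> X \<Longrightarrow> i \<in> I \<Longrightarrow> x \<in> B i \<Longrightarrow> p x \<in> B (\<alpha> i) \<and> h (p x) = f x"
    by metis
  have "restrict p X \<in> carrier (char_monoid X I B S)"
    using carrierI(1)[of "restrict p X" \<alpha>] assms(2) p block_subset by auto
  moreover have "f = compose X h (restrict p X)"
  proof (rule extensionalityI[of _ X])
    fix x assume "x \<in> X"
    then show "f x = compose X h (restrict p X) x"
      using in_block p by (fastforce simp: compose_def)
  qed (use assms(1) in \<open>auto simp: PiE_iff\<close>)
  ultimately show ?thesis by blast
qed

text \<open>The kernel condition makes \<open>g x \<mapsto> h x\<close> a function on the image of \<open>g\<close>, and the condition on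
  characters places its values in the blocks that \<open>\<delta>\<close> prescribes. A point outside the image may go
  anywhere in its prescribed block.\<close>

lemma right_factorization:
  assumes g: "g \<in> carrier (char_monoid X I B S)" and h: "h \<in> carrier (char_monoid X I B S)"
    and \<delta>: "\<delta> \<in> S" "character I B h = compose I \<delta> (character I B g)"
    and ker: "\<And>x y. x \<in> X \<Longrightarrow> y \<in> X \<Longrightarrow> g x = g y \<Longrightarrow> h x = h y"
  shows "\<exists>u\<in>carrier (char_monoid X I B S). h = compose X u g"
proof -
  have "\<exists>z. (\<forall>j\<in>I. y \<in> B j \<longrightarrow> z \<in> B (\<delta> j)) \<and> (\<forall>x\<in>X. g x = y \<longrightarrow> z = h x)"
    if y: "y \<in> X" for y
  proof (cases "y \<in> g ` X")
    case True
    then obtain x where x: "x \<in> X" "y = g x" by blast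
    obtain i where i: "i \<in> I" "x \<in> B i"
      using in_block[OF x(1)] by blast
    have "character I B g i \<in> I"
      using S_maps[OF carrierD(2)[OF g]] i(1) by auto
    then have "h x \<in> B (\<delta> j)" if "j \<in> I" "y \<in> B j" for j
    proof -
      have "j = character I B g i"
        using block_unique[OF that(1) \<open>character I B g i \<in> I\<close> that(2)] character_maps[OF g i] x(2)
        by simp
      then show ?thesis
        using character_maps[OF h i] i(1) by (simp add: \<delta>(2) compose_eq)
    qed
    moreover have "h x = h x'" if "x' \<in> X" "g x' = y" for x'
      using ker[OF x(1) that(1)] x(2) that(2) by simp
    ultimately show ?thesis
      by blast
  next
    case False
    obtain j where j: "j \<in> I" "y \<in> B j"
      using in_block[OF y] by blast
    moreover obtain z where "z \<in> B (\<delta> j)"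
      using block_nonempty[of "\<delta> j"] S_maps[OF \<delta>(1)] j by auto
    ultimately show ?thesis
      using False block_unique by blast
  qed
  then obtain u where u: "\<And>y j. y \<in> X \<Longrightarrow> j \<in> I \<Longrightarrow> y \<in> B j \<Longrightarrow> u y \<in> B (\<delta> j)"
    "\<And>y x. y \<in> X \<Longrightarrow> x \<in> X \<Longrightarrow> g x = y \<Longrightarrow> u y = h x"
    by metis
  have "restrict u X \<in> carrier (char_monoid X I B S)"
    using carrierI(1)[of "restrict u X" \<delta>] \<delta>(1) u(1) block_subset by auto
  moreover have "h = compose X (restrict u X) g"
  proof (rule extensionalityI[of _ X])
    fix x assume "x \<in> X"
    moreover from this have "g x \<in> X"
      using carrierD(1)[OF g] by auto
    ultimately show "h x = compose X (restrict u X) g x"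
      using u(2) by (simp add: compose_def)
  qed (use carrierD(1)[OF h] in \<open>auto simp: PiE_iff\<close>)
  ultimately show ?thesis by blast
qed

text \<open>Inside the monoid, \<open>\<R>\<close> splits into a condition on kernels and the relation \<open>\<R>\<close> between the
  characters, because right multipliers can be lifted from characters to maps.\<close>

lemma green_R_char_monoid_iff:
  assumes "g \<in> carrier (char_monoid X I B S)" "h \<in> carrier (char_monoid X I B S)"
  shows "(h, g) \<in> green_R (char_monoid X I B S) \<longleftrightarrow>
    (\<forall>x\<in>X. \<forall>y\<in>X. h x = h y \<longleftrightarrow> g x = g y) \<and>
    (character I B h, character I B g) \<in> green_R ((transf_monoid I)\<lparr>carrier := S\<rparr>)"
    (is "?L \<longleftrightarrow> ?K \<and> ?C")
proof
  assume ?L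
  then obtain u v where u: "u \<in> carrier (char_monoid X I B S)" "h = compose X u g"
    and v: "v \<in> carrier (char_monoid X I B S)" "g = compose X v h"
    unfolding green_R_char_monoid_divisibility by blast
  have ?K
    using u(2) v(2) by (metis compose_eq)
  moreover have "character I B h = compose I (character I B u) (character I B g)"
    "character I B g = compose I (character I B v) (character I B h)"
    using character_mult assms u v by metis+
  then have ?C
    using carrierD(2) assms u(1) v(1) unfolding green_R_S_iff by blast
  ultimately show "?K \<and> ?C" ..
next
  assume "?K \<and> ?C"
  then obtain \<delta> \<epsilon> where "\<delta> \<in> S" "character I B h = compose I \<delta> (character I B g)"
    and "\<epsilon> \<in> S" "character I B g = compose I \<epsilon> (character I B h)" and ?K
    unfolding green_R_S_iff by blast
  then have "\<exists>u\<in>carrier (char_monoid X I B S). h = compose X u g"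
    "\<exists>v\<in>carrier (char_monoid X I B S). g = compose X v h"
    using right_factorization[OF assms] right_factorization[OF assms(2,1)] by blast+
  then show ?L
    using assms unfolding green_R_char_monoid_divisibility by blast
qed

section \<open>The relation \<open>\<D>\<close>\<close>

text \<open>The middle element \<open>h\<close> of \<open>f \<L> h \<R> g\<close> shares its image with \<open>f\<close> and its kernel classes with
  \<open>g\<close>, and the multipliers between \<open>f\<close> and \<open>h\<close> carry points between classes that \<open>\<phi>\<close> matches,
  along the blocks given by their characters.\<close>

lemma class_bijection_of_green_D:
  assumes f: "f \<in> carrier (char_monoid X I B S)" and g: "g \<in> carrier (char_monoid X I B S)"
    and "(f, g) \<in> green_D (char_monoid X I B S)"
  obtains \<alpha> \<beta> \<gamma> \<phi> where "\<alpha> \<in> S" "\<beta> \<in> S" "\<gamma> \<in> S"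
    and "bij_betw \<phi> (ker_classes X f) (ker_classes X g)"
    and "character I B f = compose I \<gamma> \<alpha>" "\<gamma> = compose I (character I B f) \<beta>"
    and "(\<gamma>, character I B g) \<in> green_R ((transf_monoid I)\<lparr>carrier := S\<rparr>)"
    and "\<forall>i\<in>I. \<phi> ` ker_classes_meeting X f (B i) \<subseteq> ker_classes_meeting X g (B (\<alpha> i))"
    and "\<forall>i\<in>I. inv_into (ker_classes X f) \<phi> ` ker_classes_meeting X g (B i)
      \<subseteq> ker_classes_meeting X f (B (\<beta> i))"
proof -
  obtain h where fh: "(f, h) \<in> green_L (char_monoid X I B S)"
    and hg: "(h, g) \<in> green_R (char_monoid X I B S)"
    using assms(3) unfolding green_D_def by blast
  from fh obtain p q where h: "h \<in> carrier (char_monoid X I B S)"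
    and p: "p \<in> carrier (char_monoid X I B S)" "f = compose X h p"
    and q: "q \<in> carrier (char_monoid X I B S)" "h = compose X f q"
    unfolding green_L_char_monoid_divisibility by blast
  have pX: "p x \<in> X" "h (p x) = f x" and qX: "q x \<in> X" "f (q x) = h x" if "x \<in> X" for x
    using that PiE_mem[OF carrierD(1)[OF p(1)]] PiE_mem[OF carrierD(1)[OF q(1)]]
      compose_eq[of x X h p] compose_eq[of x X f q] p(2)[symmetric] q(2)[symmetric]
    by simp_all
  have "ker_classes X h = ker_classes X g"
    using hg green_R_char_monoid_iff[OF g h] by (intro ker_classes_cong) blast
  define \<phi> where "\<phi> M = {x \<in> X. h x \<in> f ` M}" for M
  have "f ` X = h ` X"
  proof
    show "f ` X \<subseteq> h ` X"
      using pX by (metis image_eqI image_subsetI)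
    show "h ` X \<subseteq> f ` X"
      using qX by (metis image_eqI image_subsetI)
  qed
  then have bij: "bij_betw \<phi> (ker_classes X f) (ker_classes X g)"
    using bij_betw_ker_classes_of_equal_image[of f X h] \<open>ker_classes X h = ker_classes X g\<close>
    unfolding \<phi>_def by simp
  show ?thesis
  proof (rule that[of "character I B p" "character I B q" "character I B h" \<phi>])
    show "\<forall>i\<in>I. \<phi> ` ker_classes_meeting X f (B i)
        \<subseteq> ker_classes_meeting X g (B (character I B p i))"
    proof (intro ballI image_subsetI)
      fix i M assume i: "i \<in> I" and M: "M \<in> ker_classes_meeting X f (B i)"
      then obtain x where x: "x \<in> M" "x \<in> B i"
        by (auto simp: ker_classes_meeting_def)
      then have "p x \<in> \<phi> M"
        using pX[OF block_subset[OF i x(2)]] by (auto simp: \<phi>_def)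
      then show "\<phi> M \<in> ker_classes_meeting X g (B (character I B p i))"
        using M bij character_maps[OF p(1) i x(2)]
        by (auto simp: ker_classes_meeting_def bij_betw_def)
    qed
    show "\<forall>i\<in>I. inv_into (ker_classes X f) \<phi> ` ker_classes_meeting X g (B i)
        \<subseteq> ker_classes_meeting X f (B (character I B q i))"
    proof (intro ballI image_subsetI)
      fix i N assume i: "i \<in> I" and N: "N \<in> ker_classes_meeting X g (B i)"
      define M where "M = inv_into (ker_classes X f) \<phi> N"
      have M: "M \<in> ker_classes X f" "\<phi> M = N"
        using N bij unfolding M_def
        by (auto simp: ker_classes_meeting_def bij_betw_def inv_into_into f_inv_into_f)
      obtain x where x: "x \<in> N" "x \<in> B i"
        using N by (auto simp: ker_classes_meeting_def)
      then obtain y where y: "y \<in> M" "h x = f y"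
        using M(2) by (auto simp: \<phi>_def)
      have "q x \<in> M"
        using ker_class_memD(2)[OF M(1) y(1)] y(2) qX[OF block_subset[OF i x(2)]] by simp
      then show "M \<in> ker_classes_meeting X f (B (character I B q i))"
        using M(1) character_maps[OF q(1) i x(2)] by (auto simp: ker_classes_meeting_def)
    qed
    show "(character I B h, character I B g) \<in> green_R ((transf_monoid I)\<lparr>carrier := S\<rparr>)"
      using hg green_R_char_monoid_iff[OF g h] by blast
    show "character I B f = compose I (character I B h) (character I B p)"
      using character_mult[OF p(1) h] p(2) by simp
    show "character I B h = compose I (character I B f) (character I B q)"
      using character_mult[OF q(1) f] q(2) by simp
  qed (use bij carrierD(2) p(1) q(1) h in auto)
qed

text \<open>The middle element of \<open>f \<L> h \<R> g\<close> is the transport of \<open>f\<close> along \<open>\<phi>\<close>. The block condition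
  on \<open>\<phi>\<close> provides, inside \<open>\<phi> M\<close> and the block given by \<open>\<alpha>\<close>, a point where \<open>h\<close> has the value
  of \<open>f\<close> on \<open>M\<close>; the one on its inverse does the same with \<open>f\<close> and \<open>h\<close> exchanged, and with
  \<open>\<beta>\<close> for \<open>\<alpha>\<close>.\<close>

lemma green_D_of_class_bijection:
  assumes f: "f \<in> carrier (char_monoid X I B S)" and g: "g \<in> carrier (char_monoid X I B S)"
    and S: "\<alpha> \<in> S" "\<beta> \<in> S" "\<gamma> \<in> S"
    and bij: "bij_betw \<phi> (ker_classes X f) (ker_classes X g)"
    and \<gamma>: "\<gamma> = compose I (character I B f) \<beta>"
    and R: "(\<gamma>, character I B g) \<in> green_R ((transf_monoid I)\<lparr>carrier := S\<rparr>)"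
    and ii: "\<And>i. i \<in> I \<Longrightarrow>
      \<phi> ` ker_classes_meeting X f (B i) \<subseteq> ker_classes_meeting X g (B (\<alpha> i))"
    and iii: "\<And>i. i \<in> I \<Longrightarrow> inv_into (ker_classes X f) \<phi> ` ker_classes_meeting X g (B i)
      \<subseteq> ker_classes_meeting X f (B (\<beta> i))"
  shows "(f, g) \<in> green_D (char_monoid X I B S)"
proof -
  obtain h where h: "h \<in> X \<rightarrow>\<^sub>E X"
    and val: "\<And>M x y. M \<in> ker_classes X f \<Longrightarrow> y \<in> M \<Longrightarrow> x \<in> \<phi> M \<Longrightarrow> h x = f y"
    and ker: "\<And>x y. x \<in> X \<Longrightarrow> y \<in> X \<Longrightarrow> h x = h y \<longleftrightarrow> g x = g y"
    using transport_along_class_bijection[OF carrierD(1)[OF f] bij] by blast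
  have fh: "\<exists>y\<in>B (\<alpha> i). h y = f x" if "i \<in> I" "x \<in> B i" for i x
  proof -
    define M where "M = {y \<in> X. f y = f x}"
    have x: "x \<in> X"
      using that by (rule block_subset)
    have M: "M \<in> ker_classes_meeting X f (B i)"
      unfolding M_def using that(2) x by (rule ker_class_of_meeting)
    then have "\<phi> M \<in> ker_classes_meeting X g (B (\<alpha> i))"
      using ii[OF that(1)] by blast
    then obtain y where "y \<in> \<phi> M" "y \<in> B (\<alpha> i)"
      by (auto simp: ker_classes_meeting_def)
    moreover have "M \<in> ker_classes X f" "x \<in> M"
      using M x by (auto simp: ker_classes_meeting_def M_def)
    ultimately show ?thesis
      using val by blast
  qed
  have hf: "\<exists>y\<in>B (\<beta> i). f y = h x" if "i \<in> I" "x \<in> B i" for i x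
  proof -
    define N where "N = {y \<in> X. g y = g x}"
    define M where "M = inv_into (ker_classes X f) \<phi> N"
    have x: "x \<in> X"
      using that by (rule block_subset)
    have N: "N \<in> ker_classes_meeting X g (B i)"
      unfolding N_def using that(2) x by (rule ker_class_of_meeting)
    then have "M \<in> ker_classes_meeting X f (B (\<beta> i))"
      using iii[OF that(1)] unfolding M_def by blast
    then obtain y where "M \<in> ker_classes X f" "y \<in> M" "y \<in> B (\<beta> i)"
      by (auto simp: ker_classes_meeting_def)
    moreover have "\<phi> M = N"
      unfolding M_def using N bij
      by (auto simp: ker_classes_meeting_def bij_betw_def f_inv_into_f)
    then have "x \<in> \<phi> M"
      using x by (simp add: N_def)
    ultimately show ?thesis
      using val by metis
  qed
  have maps: "h x \<in> B (\<gamma> i)" if i: "i \<in> I" "x \<in> B i" for i x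
  proof -
    obtain y where "y \<in> B (\<beta> i)" "f y = h x"
      using hf[OF i] by blast
    then show ?thesis
      using character_maps[OF f, of "\<beta> i" y] S_maps[OF S(2)] i(1) \<gamma> by (auto simp: compose_def)
  qed
  have "h \<in> extensional X"
    using h by (simp add: PiE_iff)
  note hM = carrierI[OF this S(3) maps]
  have "\<exists>p\<in>carrier (char_monoid X I B S). f = compose X h p"
    using left_factorization[OF carrierD(1)[OF f] S(1) fh] .
  moreover have "\<exists>q\<in>carrier (char_monoid X I B S). h = compose X f q"
    using left_factorization[OF h S(2) hf] .
  ultimately have "(f, h) \<in> green_L (char_monoid X I B S)"
    using f hM(1) unfolding green_L_char_monoid_divisibility by blast
  moreover have "(h, g) \<in> green_R (char_monoid X I B S)"
    using green_R_char_monoid_iff[OF g hM(1)] ker R hM(2) by blast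
  ultimately show ?thesis
    unfolding green_D_def by blast
qed

end

theorem theorem5p9:
  fixes X :: "'a set" and I :: "'i set" and B :: "'i \<Rightarrow> 'a set"
    and S :: "('i \<Rightarrow> 'i) set" and f g :: "'a \<Rightarrow> 'a"
  assumes "X \<noteq> {}"
    and "indexed_partition X I B"
    and "submonoid S (transf_monoid I)"
    and "f \<in> carrier (char_monoid X I B S)"
    and "g \<in> carrier (char_monoid X I B S)"
  shows "(f, g) \<in> green_D (char_monoid X I B S) \<longleftrightarrow>
    (\<exists>\<alpha>\<in>S. \<exists>\<beta>\<in>S. \<exists>\<gamma>\<in>S. \<exists>\<phi>.
       bij_betw \<phi> (ker_classes X f) (ker_classes X g) \<and>
       character I B f = \<alpha> \<otimes>\<^bsub>transf_monoid I\<^esub> \<gamma> \<and>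
       \<gamma> = \<beta> \<otimes>\<^bsub>transf_monoid I\<^esub> character I B f \<and>
       (\<gamma>, character I B g) \<in> green_R ((transf_monoid I)\<lparr>carrier := S\<rparr>) \<and>
       (\<forall>i\<in>I. \<phi> ` ker_classes_meeting X f (B i) \<subseteq> ker_classes_meeting X g (B (\<alpha> i))) \<and>
       (\<forall>i\<in>I. inv_into (ker_classes X f) \<phi> ` ker_classes_meeting X g (B i)
                \<subseteq> ker_classes_meeting X f (B (\<beta> i))))"
proof -
  interpret block_monoid X I B S
    using assms(2,3) by (rule block_monoid.intro)
  have mult: "\<sigma> \<otimes>\<^bsub>transf_monoid I\<^esub> \<tau> = compose I \<tau> \<sigma>" for \<sigma> \<tau>
    by (simp add: transf_monoid_def)
  show ?thesis (is "_ \<longleftrightarrow> ?R")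
  proof
    assume "(f, g) \<in> green_D (char_monoid X I B S)"
    from class_bijection_of_green_D[OF assms(4,5) this]
    obtain \<alpha> \<beta> \<gamma> \<phi> where S: "\<alpha> \<in> S" "\<beta> \<in> S" "\<gamma> \<in> S"
      and \<phi>: "bij_betw \<phi> (ker_classes X f) (ker_classes X g)"
        "character I B f = compose I \<gamma> \<alpha>" "\<gamma> = compose I (character I B f) \<beta>"
        "(\<gamma>, character I B g) \<in> green_R ((transf_monoid I)\<lparr>carrier := S\<rparr>)"
      and blocks: "\<forall>i\<in>I. \<phi> ` ker_classes_meeting X f (B i) \<subseteq> ker_classes_meeting X g (B (\<alpha> i))"
        "\<forall>i\<in>I. inv_into (ker_classes X f) \<phi> ` ker_classes_meeting X g (B i)
          \<subseteq> ker_classes_meeting X f (B (\<beta> i))" .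
    show ?R
      unfolding mult
      by (rule bexI[OF _ S(1)], rule bexI[OF _ S(2)], rule bexI[OF _ S(3)], rule exI[of _ \<phi>])
        (intro conjI \<phi> blocks)
  next
    assume ?R
    then obtain \<alpha> \<beta> \<gamma> \<phi> where S: "\<alpha> \<in> S" "\<beta> \<in> S" "\<gamma> \<in> S"
      and \<phi>: "bij_betw \<phi> (ker_classes X f) (ker_classes X g)"
        "\<gamma> = compose I (character I B f) \<beta>"
        "(\<gamma>, character I B g) \<in> green_R ((transf_monoid I)\<lparr>carrier := S\<rparr>)"
      and blocks: "\<forall>i\<in>I. \<phi> ` ker_classes_meeting X f (B i) \<subseteq> ker_classes_meeting X g (B (\<alpha> i))"
        "\<forall>i\<in>I. inv_into (ker_classes X f) \<phi> ` ker_classes_meeting X g (B i)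
          \<subseteq> ker_classes_meeting X f (B (\<beta> i))"
      unfolding mult by (elim bexE exE conjE)
    show "(f, g) \<in> green_D (char_monoid X I B S)"
      by (rule green_D_of_class_bijection[OF assms(4,5) S \<phi> bspec[OF blocks(1)] bspec[OF blocks(2)]])
  qed
qed

end
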